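(* Let $(S,\rho)$ be a semi-metric space. Let $(S_1,\rho_1)$ be the metric space obtained by first completing $(S,\rho)$ as a semi-metric space and then taking the quotient by points at distance zero (procedure (I)), and let $(S_2,\rho_2)$ be the metric space obtained by first taking the quotient of $(S,\rho)$ by points at distance zero and then completing the resulting metric space (procedure (II)). Then the metric spaces $(S_1,\rho_1)$ and $(S_2,\rho_2)$ are isometric, that is, there exists an isometric bijection $J:S_1\to S_2$.
   Context: A semi-metric space $(S,\rho)$ is a set $S$ with a map $\rho:S\times S\to[0,\infty)$ satisfying $\rho(x,x)=0$, $\rho(x,y)=\rho(y,x)$, and $\rho(x,y)\le\rho(x,z)+\rho(z,y)$ for all $x,y,z\in S$ (distinct points may have $\rho(x,y)=0$). Cauchy sequences are defined as usual. Procedure (I). Let $\widetilde S_1$ be the set of all Cauchy sequences in $S$, with semi-metric $\widetilde\rho_1(\widetilde x,\widetilde y)=\lim_{n\to\infty}\rho(x(n),y(n))$ for $\widetilde x=\{x(n)\}_{n\in\mathbb N}$, $\widetilde y=\{y(n)\}_{n\in\mathbb N}$. Define $\widetilde x\sim\widetilde y$ whenever $\widetilde\rho_1(\widetilde x,\widetilde y)=0$, let $S_1=\widetilde S_1/{\sim}$ be the set of equivalence classes $[\widetilde x]_{\widetilde\rho_1}$, and put $\rho_1([\widetilde x]_{\widetilde\rho_1},[\widetilde y]_{\widetilde\rho_1})=\widetilde\rho_1(\widetilde x,\widetilde y)$, which is a well-defined metric. Procedure (II). Define $x\sim y$ on $S$ whenever $\rho(x,y)=0$, let $M=S/{\sim}$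 be the set of equivalence classes $[x]_\rho$, with the well-defined metric $d([x]_\rho,[y]_\rho)=\rho(x,y)$. Let $\widehat S_2$ be the set of all Cauchy sequences in $(M,d)$, with semi-metric $\widehat\rho_2(\widehat x,\widehat y)=\lim_{n\to\infty}d([x]_\rho(n),[y]_\rho(n))$ for $\widehat x=\{[x]_\rho(n)\}_{n\in\mathbb N}$, $\widehat y=\{[y]_\rho(n)\}_{n\in\mathbb N}$. Define $\widehat x\sim\widehat y$ whenever $\widehat\rho_2(\widehat x,\widehat y)=0$, let $S_2=\widehat S_2/{\sim}$ be the set of equivalence classes $[\widehat x]_{\widehat\rho_2}$, and put $\rho_2([\widehat x]_{\widehat\rho_2},[\widehat y]_{\widehat\rho_2})=\widehat\rho_2(\widehat x,\widehat y)$, which is a well-defined metric. *)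

theory Defs
  imports "HOL-Analysis.Abstract_Metric_Spaces"
begin

text \<open>The axioms constrain \<open>\<rho>\<close> on the carrier only, whereas the library's \<open>Metric_space\<close> demands
  non-negativity and symmetry everywhere.\<close>

locale semi_metric_space =
  fixes S :: "'a set" and \<rho> :: "'a \<Rightarrow> 'a \<Rightarrow> real"
  assumes nonneg: "\<lbrakk>x \<in> S; y \<in> S\<rbrakk> \<Longrightarrow> 0 \<le> \<rho> x y"
    and refl: "x \<in> S \<Longrightarrow> \<rho> x x = 0"
    and commute: "\<lbrakk>x \<in> S; y \<in> S\<rbrakk> \<Longrightarrow> \<rho> x y = \<rho> y x"
    and triangle: "\<lbrakk>x \<in> S; y \<in> S; z \<in> S\<rbrakk> \<Longrightarrow> \<rho> x y \<le> \<rho> x z + \<rho> z y"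

definition zero_dist_rel :: "'a set \<Rightarrow> ('a \<Rightarrow> 'a \<Rightarrow> real) \<Rightarrow> ('a \<times> 'a) set" where
  "zero_dist_rel S \<rho> = {(x, y). x \<in> S \<and> y \<in> S \<and> \<rho> x y = 0}"

definition quot_space :: "'a set \<Rightarrow> ('a \<Rightarrow> 'a \<Rightarrow> real) \<Rightarrow> 'a set set" where
  "quot_space S \<rho> = S // zero_dist_rel S \<rho>"

text \<open>The common value of \<open>\<rho>\<close> on representatives (see \<open>quot_dist_class\<close> below). The value \<open>0\<close> off
  the quotient is a convention needed only so that the library's \<open>Metric_space\<close> applies.\<close>

definition quot_dist :: "'a set \<Rightarrow> ('a \<Rightarrow> 'a \<Rightarrow> real) \<Rightarrow> 'a set \<Rightarrow> 'a set \<Rightarrow> real" where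
  "quot_dist S \<rho> A B =
     (if A \<in> quot_space S \<rho> \<and> B \<in> quot_space S \<rho>
      then THE r. \<exists>x\<in>A. \<exists>y\<in>B. r = \<rho> x y else 0)"

text \<open>For a metric space this is the library's \<open>MCauchy\<close> (lemma \<open>cauchy_seqs_eq_MCauchy\<close>), which is
  not available for semi-metrics.\<close>

definition cauchy_seqs :: "'a set \<Rightarrow> ('a \<Rightarrow> 'a \<Rightarrow> real) \<Rightarrow> (nat \<Rightarrow> 'a) set" where
  "cauchy_seqs S \<rho> =
     {x. range x \<subseteq> S \<and> (\<forall>\<epsilon>>0. \<exists>N. \<forall>m n. N \<le> m \<longrightarrow> N \<le> n \<longrightarrow> \<rho> (x m) (x n) < \<epsilon>)}"

definition cauchy_dist :: "('a \<Rightarrow> 'a \<Rightarrow> real) \<Rightarrow> (nat \<Rightarrow> 'a) \<Rightarrow> (nat \<Rightarrow> 'a) \<Rightarrow> real" where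
  "cauchy_dist \<rho> x y = lim (\<lambda>n. \<rho> (x n) (y n))"

text \<open>First complete, then identify points at distance zero.\<close>

definition space_I :: "'a set \<Rightarrow> ('a \<Rightarrow> 'a \<Rightarrow> real) \<Rightarrow> (nat \<Rightarrow> 'a) set set" where
  "space_I S \<rho> = quot_space (cauchy_seqs S \<rho>) (cauchy_dist \<rho>)"

definition dist_I ::
  "'a set \<Rightarrow> ('a \<Rightarrow> 'a \<Rightarrow> real) \<Rightarrow> (nat \<Rightarrow> 'a) set \<Rightarrow> (nat \<Rightarrow> 'a) set \<Rightarrow> real" where
  "dist_I S \<rho> = quot_dist (cauchy_seqs S \<rho>) (cauchy_dist \<rho>)"

text \<open>First identify points at distance zero, then complete the resulting metric space.\<close>

definition space_II :: "'a set \<Rightarrow> ('a \<Rightarrow> 'a \<Rightarrow> real) \<Rightarrow> (nat \<Rightarrow> 'a set) set set" where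
  "space_II S \<rho> =
     quot_space (cauchy_seqs (quot_space S \<rho>) (quot_dist S \<rho>)) (cauchy_dist (quot_dist S \<rho>))"

definition dist_II ::
  "'a set \<Rightarrow> ('a \<Rightarrow> 'a \<Rightarrow> real) \<Rightarrow> (nat \<Rightarrow> 'a set) set \<Rightarrow> (nat \<Rightarrow> 'a set) set \<Rightarrow> real" where
  "dist_II S \<rho> =
     quot_dist (cauchy_seqs (quot_space S \<rho>) (quot_dist S \<rho>)) (cauchy_dist (quot_dist S \<rho>))"


text \<open>Well-definedness of the constructions.\<close>

lemma cauchy_seqs_eq_MCauchy:
  assumes "Metric_space M d"
  shows "cauchy_seqs M d = {x. Metric_space.MCauchy M d x}"
  by (simp add: cauchy_seqs_def Metric_space.MCauchy_def[OF assms])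

lemma semi_metric_space_Metric_space:
  assumes "Metric_space M d"
  shows "semi_metric_space M d"
proof -
  interpret Metric_space M d by fact
  show ?thesis
    by unfold_locales (simp_all add: commute, metis commute triangle)
qed

context semi_metric_space
begin

lemma equiv_zero_dist_rel: "equiv S (zero_dist_rel S \<rho>)"
proof (rule equivI)
  show "zero_dist_rel S \<rho> \<subseteq> S \<times> S"
    by (auto simp: zero_dist_rel_def)
  show "refl_on S (zero_dist_rel S \<rho>)"
    by (auto simp: refl_on_def zero_dist_rel_def refl)
  show "sym (zero_dist_rel S \<rho>)"
    by (auto simp: sym_def zero_dist_rel_def commute)
  show "trans (zero_dist_rel S \<rho>)"
  proof (rule transI)
    fix x y z assume "(x, y) \<in> zero_dist_rel S \<rho>" "(y, z) \<in> zero_dist_rel S \<rho>"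
    then show "(x, z) \<in> zero_dist_rel S \<rho>"
      using triangle[of x z y] nonneg[of x z] by (simp add: zero_dist_rel_def)
  qed
qed

lemma dist_cong:
  assumes "x \<in> S" "x' \<in> S" "y \<in> S" "y' \<in> S" "\<rho> x x' = 0" "\<rho> y y' = 0"
  shows "\<rho> x y = \<rho> x' y'"
proof -
  have "\<rho> x y \<le> \<rho> x' y'"
    using triangle[of x y x'] triangle[of x' y y'] commute[of y y'] assms by simp
  moreover have "\<rho> x' y' \<le> \<rho> x y"
    using triangle[of x' y' x] triangle[of x y' y] commute[of x x'] assms by simp
  ultimately show ?thesis by simp
qed

lemma quot_dist_class:
  assumes "x \<in> S" "y \<in> S"
  shows "quot_dist S \<rho> (zero_dist_rel S \<rho> `` {x}) (zero_dist_rel S \<rho> `` {y}) = \<rho> x y"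
proof -
  have "(THE r. \<exists>u\<in>zero_dist_rel S \<rho> `` {x}. \<exists>v\<in>zero_dist_rel S \<rho> `` {y}. r = \<rho> u v) = \<rho> x y"
  proof (rule the_equality)
    show "\<exists>u\<in>zero_dist_rel S \<rho> `` {x}. \<exists>v\<in>zero_dist_rel S \<rho> `` {y}. \<rho> x y = \<rho> u v"
      using assms by (intro bexI[of _ x] bexI[of _ y]) (auto simp: zero_dist_rel_def refl)
  next
    fix r assume "\<exists>u\<in>zero_dist_rel S \<rho> `` {x}. \<exists>v\<in>zero_dist_rel S \<rho> `` {y}. r = \<rho> u v"
    then obtain u v where "u \<in> S" "v \<in> S" "\<rho> x u = 0" "\<rho> y v = 0" and r: "r = \<rho> u v"
      by (auto simp: zero_dist_rel_def)
    then show "r = \<rho> x y"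
      unfolding r by (intro dist_cong[symmetric] assms)
  qed
  then show ?thesis
    using assms by (simp add: quot_dist_def quot_space_def quotientI)
qed

lemma quot_space_cases:
  assumes "A \<in> quot_space S \<rho>"
  obtains x where "x \<in> S" "A = zero_dist_rel S \<rho> `` {x}"
  using assms by (auto simp: quot_space_def elim: quotientE)

lemma Metric_space_quot: "Metric_space (quot_space S \<rho>) (quot_dist S \<rho>)"
proof
  fix A B
  show "0 \<le> quot_dist S \<rho> A B"
  proof (cases "A \<in> quot_space S \<rho> \<and> B \<in> quot_space S \<rho>")
    case True
    obtain x where x: "x \<in> S" and A: "A = zero_dist_rel S \<rho> `` {x}"
      using True by (blast elim: quot_space_cases)
    obtain y where y: "y \<in> S" and B: "B = zero_dist_rel S \<rho> `` {y}"
      using True by (blast elim: quot_space_cases)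
    show ?thesis
      unfolding A B quot_dist_class[OF x y] by (rule nonneg[OF x y])
  qed (auto simp: quot_dist_def)
  show "quot_dist S \<rho> A B = quot_dist S \<rho> B A"
  proof (cases "A \<in> quot_space S \<rho> \<and> B \<in> quot_space S \<rho>")
    case True
    obtain x where x: "x \<in> S" and A: "A = zero_dist_rel S \<rho> `` {x}"
      using True by (blast elim: quot_space_cases)
    obtain y where y: "y \<in> S" and B: "B = zero_dist_rel S \<rho> `` {y}"
      using True by (blast elim: quot_space_cases)
    show ?thesis
      unfolding A B quot_dist_class[OF x y] quot_dist_class[OF y x] by (rule commute[OF x y])
  qed (auto simp: quot_dist_def)
next
  fix A B assume AB: "A \<in> quot_space S \<rho>" "B \<in> quot_space S \<rho>"
  obtain x where x: "x \<in> S" and A: "A = zero_dist_rel S \<rho> `` {x}"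
    using AB(1) by (rule quot_space_cases)
  obtain y where y: "y \<in> S" and B: "B = zero_dist_rel S \<rho> `` {y}"
    using AB(2) by (rule quot_space_cases)
  have "A = B \<longleftrightarrow> (x, y) \<in> zero_dist_rel S \<rho>"
    unfolding A B by (rule eq_equiv_class_iff[OF equiv_zero_dist_rel x y])
  moreover have "quot_dist S \<rho> A B = \<rho> x y"
    unfolding A B by (rule quot_dist_class[OF x y])
  ultimately show "quot_dist S \<rho> A B = 0 \<longleftrightarrow> A = B"
    using x y by (simp only: zero_dist_rel_def mem_Collect_eq case_prod_conv simp_thms)
next
  fix A B C assume ABC: "A \<in> quot_space S \<rho>" "B \<in> quot_space S \<rho>" "C \<in> quot_space S \<rho>"
  obtain x where x: "x \<in> S" and A: "A = zero_dist_rel S \<rho> `` {x}"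
    using ABC(1) by (rule quot_space_cases)
  obtain y where y: "y \<in> S" and B: "B = zero_dist_rel S \<rho> `` {y}"
    using ABC(2) by (rule quot_space_cases)
  obtain z where z: "z \<in> S" and C: "C = zero_dist_rel S \<rho> `` {z}"
    using ABC(3) by (rule quot_space_cases)
  show "quot_dist S \<rho> A C \<le> quot_dist S \<rho> A B + quot_dist S \<rho> B C"
    unfolding A B C quot_dist_class[OF x z] quot_dist_class[OF x y] quot_dist_class[OF y z]
    by (rule triangle[OF x z y])
qed

lemma cauchy_dist_LIMSEQ:
  assumes "x \<in> cauchy_seqs S \<rho>" "y \<in> cauchy_seqs S \<rho>"
  shows "(\<lambda>n. \<rho> (x n) (y n)) \<longlonglongrightarrow> cauchy_dist \<rho> x y"
proof -
  have S: "x n \<in> S" "y n \<in> S" for n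
    using assms by (auto simp: cauchy_seqs_def)
  have "Cauchy (\<lambda>n. \<rho> (x n) (y n))"
  proof (rule metric_CauchyI)
    fix e :: real assume "e > 0"
    then have "e / 2 > 0" by simp
    obtain N1 where N1: "\<And>m n. N1 \<le> m \<Longrightarrow> N1 \<le> n \<Longrightarrow> \<rho> (x m) (x n) < e / 2"
      using assms(1) \<open>e / 2 > 0\<close> unfolding cauchy_seqs_def by blast
    obtain N2 where N2: "\<And>m n. N2 \<le> m \<Longrightarrow> N2 \<le> n \<Longrightarrow> \<rho> (y m) (y n) < e / 2"
      using assms(2) \<open>e / 2 > 0\<close> unfolding cauchy_seqs_def by blast
    have "dist (\<rho> (x m) (y m)) (\<rho> (x n) (y n)) < e" if "m \<ge> max N1 N2" "n \<ge> max N1 N2" for m n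
    proof -
      have *: "\<rho> (x i) (y i) - \<rho> (x j) (y j) < e" if "i \<ge> max N1 N2" "j \<ge> max N1 N2" for i j
      proof -
        have "\<rho> (x i) (x j) < e / 2" "\<rho> (y j) (y i) < e / 2"
          using N1 N2 that by simp_all
        then show ?thesis
          using triangle[OF S(1) S(2) S(1), of i i j] triangle[OF S(1) S(2) S(2), of j i j]
          by linarith
      qed
      show ?thesis
        using *[of m n] *[of n m] that by (simp add: dist_real_def abs_if)
    qed
    then show "\<exists>M. \<forall>m\<ge>M. \<forall>n\<ge>M. dist (\<rho> (x m) (y m)) (\<rho> (x n) (y n)) < e"
      by blast
  qed
  then show ?thesis
    unfolding cauchy_dist_def by (simp add: Cauchy_convergent_iff convergent_LIMSEQ_iff)
qed

lemma semi_metric_space_cauchy: "semi_metric_space (cauchy_seqs S \<rho>) (cauchy_dist \<rho>)"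
proof
  have S: "x n \<in> S" if "x \<in> cauchy_seqs S \<rho>" for x n
    using that by (auto simp: cauchy_seqs_def)
  fix x y
  assume x: "x \<in> cauchy_seqs S \<rho>"
  show "cauchy_dist \<rho> x x = 0"
    by (simp add: cauchy_dist_def refl[OF S[OF x]])
  assume y: "y \<in> cauchy_seqs S \<rho>"
  show "0 \<le> cauchy_dist \<rho> x y"
    using LIMSEQ_le_const[OF cauchy_dist_LIMSEQ[OF x y]] nonneg[OF S[OF x] S[OF y]] by blast
  have "\<rho> (x n) (y n) = \<rho> (y n) (x n)" for n
    by (rule commute[OF S[OF x] S[OF y]])
  then show "cauchy_dist \<rho> x y = cauchy_dist \<rho> y x"
    by (simp only: cauchy_dist_def)
  fix z
  assume z: "z \<in> cauchy_seqs S \<rho>"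
  show "cauchy_dist \<rho> x y \<le> cauchy_dist \<rho> x z + cauchy_dist \<rho> z y"
  proof (rule LIMSEQ_le)
    show "(\<lambda>n. \<rho> (x n) (y n)) \<longlonglongrightarrow> cauchy_dist \<rho> x y"
      by (rule cauchy_dist_LIMSEQ[OF x y])
    show "(\<lambda>n. \<rho> (x n) (z n) + \<rho> (z n) (y n)) \<longlonglongrightarrow> cauchy_dist \<rho> x z + cauchy_dist \<rho> z y"
      by (rule tendsto_add[OF cauchy_dist_LIMSEQ[OF x z] cauchy_dist_LIMSEQ[OF z y]])
    show "\<exists>N. \<forall>n\<ge>N. \<rho> (x n) (y n) \<le> \<rho> (x n) (z n) + \<rho> (z n) (y n)"
      using triangle[OF S[OF x] S[OF y] S[OF z]] by blast
  qed
qed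

lemma Metric_space_I: "Metric_space (space_I S \<rho>) (dist_I S \<rho>)"
  unfolding space_I_def dist_I_def
  by (rule semi_metric_space.Metric_space_quot[OF semi_metric_space_cauchy])

lemma Metric_space_II: "Metric_space (space_II S \<rho>) (dist_II S \<rho>)"
  unfolding space_II_def dist_II_def
  by (intro semi_metric_space.Metric_space_quot semi_metric_space.semi_metric_space_cauchy
      semi_metric_space_Metric_space Metric_space_quot)

end

end

theory Submission
  imports Defs
begin

text \<open>A distance-preserving surjection between semi-metric spaces induces an isometric bijection of
  the quotients. Passing from a sequence to the sequence of classes of its terms is such a
  surjection from the Cauchy sequences in \<open>S\<close> onto those in the quotient of \<open>S\<close>: choosing
  representatives termwise gives a preimage.\<close>

lemma quot_space_isometry:
  assumes X: "semi_metric_space X d" and Y: "semi_metric_space Y e"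
    and surj: "f ` X = Y"
    and iso: "\<And>x y. \<lbrakk>x \<in> X; y \<in> X\<rbrakk> \<Longrightarrow> e (f x) (f y) = d x y"
  shows "bij_betw ((`) f) (quot_space X d) (quot_space Y e)"
    and "\<lbrakk>A \<in> quot_space X d; B \<in> quot_space X d\<rbrakk>
      \<Longrightarrow> quot_dist Y e (f ` A) (f ` B) = quot_dist X d A B"
proof -
  interpret X: semi_metric_space X d by fact
  interpret Y: semi_metric_space Y e by fact
  interpret QX: Metric_space "quot_space X d" "quot_dist X d" by (rule X.Metric_space_quot)
  interpret QY: Metric_space "quot_space Y e" "quot_dist Y e" by (rule Y.Metric_space_quot)
  \<comment> \<open>Preserving zero distances puts the image inside the class of \<open>f x\<close>.
    Surjectivity makes it the whole class, since every point of \<open>Y\<close> at distance zero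
    from \<open>f x\<close> has a preimage. Taking images is therefore the induced map on classes,
    with no choice of representatives.\<close>
  have image_class: "f ` (zero_dist_rel X d `` {x}) = zero_dist_rel Y e `` {f x}" if "x \<in> X" for x
    using that iso unfolding zero_dist_rel_def surj[symmetric] by auto
  have dist: "quot_dist Y e (f ` A) (f ` B) = quot_dist X d A B"
    if A: "A \<in> quot_space X d" and B: "B \<in> quot_space X d" for A B
  proof -
    obtain x where x: "x \<in> X" "A = zero_dist_rel X d `` {x}"
      using A by (rule X.quot_space_cases)
    obtain y where y: "y \<in> X" "B = zero_dist_rel X d `` {y}"
      using B by (rule X.quot_space_cases)
    have "f x \<in> Y" "f y \<in> Y"
      using x y surj by auto
    then show ?thesis
      using x y by (simp add: image_class X.quot_dist_class Y.quot_dist_class iso)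
  qed
  then show "\<lbrakk>A \<in> quot_space X d; B \<in> quot_space X d\<rbrakk>
      \<Longrightarrow> quot_dist Y e (f ` A) (f ` B) = quot_dist X d A B" .
  \<comment> \<open>\<open>f\<close> itself may identify points of \<open>X\<close>, but only those
    at distance zero. Injectivity on classes thus comes from \<open>dist\<close> and the fact that
    the quotient metric separates points.\<close>
  have "inj_on ((`) f) (quot_space X d)"
  proof (rule inj_onI)
    fix A B assume AB: "A \<in> quot_space X d" "B \<in> quot_space X d" and eq: "f ` A = f ` B"
    have "f ` B \<in> quot_space Y e"
      using AB(2) surj by (elim X.quot_space_cases) (auto simp: image_class quot_space_def intro: quotientI)
    then have "quot_dist X d A B = 0"
      using dist[OF AB] eq by simp
    then show "A = B"
      using QX.zero AB by blast
  qed
  moreover have "(`) f ` quot_space X d = quot_space Y e"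
  proof -
    have "quot_space X d = (\<lambda>x. zero_dist_rel X d `` {x}) ` X"
      by (auto simp: quot_space_def quotient_def)
    moreover have "quot_space Y e = (\<lambda>y. zero_dist_rel Y e `` {y}) ` f ` X"
      unfolding surj by (auto simp: quot_space_def quotient_def)
    ultimately show ?thesis
      by (simp add: image_image image_class)
  qed
  ultimately show "bij_betw ((`) f) (quot_space X d) (quot_space Y e)"
    by (simp add: bij_betw_def)
qed

context semi_metric_space
begin

lemma class_in_quot_space:
  assumes "x \<in> S"
  shows "zero_dist_rel S \<rho> `` {x} \<in> quot_space S \<rho>"
  using assms by (simp add: quot_space_def quotientI)

text \<open>The distance of two classes is the distance of any representatives, so both Cauchy
  conditions are the same inequalities between terms.\<close>

lemma cauchy_seqs_classes:
  assumes "range x \<subseteq> S"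
  shows "(\<lambda>n. zero_dist_rel S \<rho> `` {x n}) \<in> cauchy_seqs (quot_space S \<rho>) (quot_dist S \<rho>)
    \<longleftrightarrow> x \<in> cauchy_seqs S \<rho>"
proof -
  have "x n \<in> S" for n
    using assms by auto
  then show ?thesis
    by (auto simp: cauchy_seqs_def quot_dist_class class_in_quot_space)
qed

lemma cauchy_dist_classes:
  assumes "range x \<subseteq> S" "range y \<subseteq> S"
  shows "cauchy_dist (quot_dist S \<rho>) (\<lambda>n. zero_dist_rel S \<rho> `` {x n}) (\<lambda>n. zero_dist_rel S \<rho> `` {y n})
    = cauchy_dist \<rho> x y"
proof -
  have "x n \<in> S" "y n \<in> S" for n
    using assms by auto
  then show ?thesis
    by (simp add: cauchy_dist_def quot_dist_class)
qed

text \<open>This is the surjectivity that \<open>quot_space_isometry\<close> requires of the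
  termwise class map.\<close>

lemma cauchy_seqs_quot:
  "(\<lambda>x n. zero_dist_rel S \<rho> `` {x n}) ` cauchy_seqs S \<rho>
    = cauchy_seqs (quot_space S \<rho>) (quot_dist S \<rho>)" (is "?f ` _ = ?C")
proof (intro equalityI subsetI)
  fix c assume "c \<in> ?f ` cauchy_seqs S \<rho>"
  then obtain x where x: "x \<in> cauchy_seqs S \<rho>" and c: "c = ?f x"
    by blast
  have "range x \<subseteq> S"
    using x by (simp add: cauchy_seqs_def)
  then show "c \<in> ?C"
    using x c by (simp add: cauchy_seqs_classes)
next
  fix c assume c: "c \<in> ?C"
  then have "c n \<in> quot_space S \<rho>" for n
    by (auto simp: cauchy_seqs_def)
  then have "\<exists>x. x \<in> S \<and> c n = zero_dist_rel S \<rho> `` {x}" for n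
    by (metis quot_space_cases)
  \<comment> \<open>Representatives are chosen independently for each \<open>n\<close>. By
    \<open>cauchy_seqs_classes\<close> any such choice is Cauchy, since \<open>c\<close> is.\<close>
  then obtain x where x: "\<And>n. x n \<in> S" and cx: "\<And>n. c n = zero_dist_rel S \<rho> `` {x n}"
    by metis
  have "c = ?f x"
    using cx by (rule ext)
  moreover have "range x \<subseteq> S"
    using x by auto
  ultimately show "c \<in> ?f ` cauchy_seqs S \<rho>"
    using c cauchy_seqs_classes by blast
qed

end

theorem lemmaA1:
  fixes S :: "'a set" and \<rho> :: "'a \<Rightarrow> 'a \<Rightarrow> real"
  assumes "semi_metric_space S \<rho>"
  shows "\<exists>J. bij_betw J (space_I S \<rho>) (space_II S \<rho>) \<and>
    (\<forall>A\<in>space_I S \<rho>. \<forall>B\<in>space_I S \<rho>. dist_II S \<rho> (J A) (J B) = dist_I S \<rho> A B)"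
proof -
  interpret semi_metric_space S \<rho> by fact
  have II: "semi_metric_space (cauchy_seqs (quot_space S \<rho>) (quot_dist S \<rho>))
      (cauchy_dist (quot_dist S \<rho>))"
    by (intro semi_metric_space.semi_metric_space_cauchy semi_metric_space_Metric_space
        Metric_space_quot)
  have "cauchy_dist (quot_dist S \<rho>) (\<lambda>n. zero_dist_rel S \<rho> `` {x n}) (\<lambda>n. zero_dist_rel S \<rho> `` {y n})
      = cauchy_dist \<rho> x y" if "x \<in> cauchy_seqs S \<rho>" "y \<in> cauchy_seqs S \<rho>" for x y
    using that by (intro cauchy_dist_classes) (auto simp: cauchy_seqs_def)
  \<comment> \<open>The witness \<open>J\<close> sends a class of Cauchy sequences to its image
    under the termwise class map.\<close>
  note quot_space_isometry[where f = "\<lambda>x n. zero_dist_rel S \<rho> `` {x n}",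
      OF semi_metric_space_cauchy II cauchy_seqs_quot this]
  then show ?thesis
    unfolding space_I_def space_II_def dist_I_def dist_II_def by blast
qed

end
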